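(* Let $n\ge1$ and let $a_1\le\cdots\le a_n$ be real numbers, not all zero. If $a_i\in\mathbb{Q}$ for $i=1,\ldots,n$, then the Lie group $G_{(a_1,\ldots,a_n)}$ admits lattices.
   Context: $H_{2n+1}$ is the Heisenberg group: $\mathbb{R}^{2n+1}$ with product $(z,x_1,y_1,\dots,x_n,y_n)\cdot(z',x'_1,y'_1,\dots,x'_n,y'_n)=(z+z'+\frac12\sum_{j=1}^n(x_jy'_j-x'_jy_j),\,x_1+x'_1,\,y_1+y'_1,\dots,x_n+x_n',\,y_n+y'_n)$. The homomorphism $\varphi:\mathbb{R}\to\operatorname{Aut}(H_{2n+1})$ is such that $\varphi(t)$ fixes the coordinate $z$ and acts on each pair $(x_j,y_j)$ by the rotation matrix $\begin{pmatrix}\cos(a_jt)&-\sin(a_jt)\\ \sin(a_jt)&\cos(a_jt)\end{pmatrix}$. $G_{(a_1,\ldots,a_n)}=\mathbb{R}\ltimes_\varphi H_{2n+1}$ is the semidirect product. A lattice in a simply connected Lie group $G$ is a discrete subgroup $\Gamma$ such that $\Gamma\backslash G$ is compact. *)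

theory Defs
  imports "HOL-Analysis.Analysis" "HOL-Algebra.Coset" "HOL-Algebra.Bij"
begin

section \<open>Semidirect products\<close>

definition real_group :: "real monoid"
  where "real_group = \<lparr>carrier = UNIV, monoid.mult = (+), one = 0\<rparr>"

lemma group_real_group: "group real_group"
proof (rule groupI)
  fix x :: real
  show "\<exists>y\<in>carrier real_group. y \<otimes>\<^bsub>real_group\<^esub> x = \<one>\<^bsub>real_group\<^esub>"
    by (rule bexI[of _ "- x"]) (auto simp: real_group_def)
qed (auto simp: real_group_def)

text \<open>The first factor acts on the second one, so that
  \<^term>\<open>(\<one>\<^bsub>K\<^esub>, h)\<close> runs through the normal factor and
  \<open>(k, \<one>) \<cdot> (\<one>, h) \<cdot> (k, \<one>)\<inverse> = (\<one>, \<phi> k h)\<close>.\<close>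

definition semidirect_product ::
    "('k, 'c) monoid_scheme \<Rightarrow> ('h, 'd) monoid_scheme \<Rightarrow> ('k \<Rightarrow> 'h \<Rightarrow> 'h) \<Rightarrow> ('k \<times> 'h) monoid"
  where "semidirect_product K H \<phi> =
    \<lparr>carrier = carrier K \<times> carrier H,
     monoid.mult = (\<lambda>(k, h) (k', h'). (k \<otimes>\<^bsub>K\<^esub> k', h \<otimes>\<^bsub>H\<^esub> \<phi> k h')),
     one = (\<one>\<^bsub>K\<^esub>, \<one>\<^bsub>H\<^esub>)\<rparr>"


section \<open>Topological groups and lattices\<close>

definition topological_group :: "('a, 'c) monoid_scheme \<Rightarrow> 'a topology \<Rightarrow> bool"
  where "topological_group G T \<longleftrightarrow>
    group G \<and> topspace T = carrier G \<and>
    continuous_map (prod_topology T T) T (\<lambda>(x, y). x \<otimes>\<^bsub>G\<^esub> y) \<and>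
    continuous_map T T (\<lambda>x. inv\<^bsub>G\<^esub> x)"

definition quotient_topology :: "'a topology \<Rightarrow> ('a \<Rightarrow> 'b) \<Rightarrow> 'b topology"
  where "quotient_topology T f =
    topology (\<lambda>U. U \<subseteq> f ` topspace T \<and> openin T {x \<in> topspace T. f x \<in> U})"

lemma openin_quotient_topology:
  "openin (quotient_topology T f) U \<longleftrightarrow>
     U \<subseteq> f ` topspace T \<and> openin T {x \<in> topspace T. f x \<in> U}"
proof -
  let ?P = "\<lambda>U. U \<subseteq> f ` topspace T \<and> openin T {x \<in> topspace T. f x \<in> U}"
  have "istopology ?P"
    unfolding istopology_def
  proof (intro conjI allI impI)
    fix A B assume A: "?P A" and B: "?P B"
    show "A \<inter> B \<subseteq> f ` topspace T" using A by blast
    have "{x \<in> topspace T. f x \<in> A \<inter> B} =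
      {x \<in> topspace T. f x \<in> A} \<inter> {x \<in> topspace T. f x \<in> B}" by blast
    then show "openin T {x \<in> topspace T. f x \<in> A \<inter> B}"
      using A B by (simp only: openin_Int)
  next
    fix \<K> assume K: "\<forall>A\<in>\<K>. ?P A"
    show "\<Union>\<K> \<subseteq> f ` topspace T" using K by blast
    have "{x \<in> topspace T. f x \<in> \<Union>\<K>} = (\<Union>A\<in>\<K>. {x \<in> topspace T. f x \<in> A})" by blast
    moreover have "openin T (\<Union>A\<in>\<K>. {x \<in> topspace T. f x \<in> A})"
      using K by blast
    ultimately show "openin T {x \<in> topspace T. f x \<in> \<Union>\<K>}" by (simp only:)
  qed
  then show ?thesis
    unfolding quotient_topology_def by (simp only: topology_inverse')
qed

lemma topspace_quotient_topology: "topspace (quotient_topology T f) = f ` topspace T"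
proof
  show "topspace (quotient_topology T f) \<subseteq> f ` topspace T"
    by (auto simp: topspace_def openin_quotient_topology)
  have "{x \<in> topspace T. f x \<in> f ` topspace T} = topspace T" by blast
  then have "openin (quotient_topology T f) (f ` topspace T)"
    by (simp add: openin_quotient_topology)
  then show "f ` topspace T \<subseteq> topspace (quotient_topology T f)"
    by (rule openin_subset)
qed

lemma quotient_map_quotient_topology: "quotient_map T (quotient_topology T f) f"
  by (simp add: quotient_map_def topspace_quotient_topology openin_quotient_topology)

text \<open>The quotient \<open>\<Gamma>\G\<close> consists of the right cosets \<open>\<Gamma> g\<close>.\<close>

definition lattice_in :: "('a, 'c) monoid_scheme \<Rightarrow> 'a topology \<Rightarrow> 'a set \<Rightarrow> bool"
  where "lattice_in G T \<Gamma> \<longleftrightarrow>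
    subgroup \<Gamma> G \<and>
    subtopology T \<Gamma> = discrete_topology \<Gamma> \<and>
    compact_space (quotient_topology T (\<lambda>g. \<Gamma> #>\<^bsub>G\<^esub> g))"

lemma topspace_lattice_quotient:
  assumes "topspace T = carrier G"
  shows "topspace (quotient_topology T (\<lambda>g. \<Gamma> #>\<^bsub>G\<^esub> g)) = rcosets\<^bsub>G\<^esub> \<Gamma>"
  using assms by (auto simp: topspace_quotient_topology RCOSETS_def)


section \<open>The Heisenberg group and the groups \<open>G\<^sub>a\<close>\<close>

text \<open>Points of \<open>\<real>\<^bsup>2n+1\<^esup>\<close> are written \<open>(z, v)\<close> with \<open>v $ j = (x\<^sub>j, y\<^sub>j)\<close>;
  \<open>n\<close> is the cardinality of the index type.\<close>

type_synonym 'n heis = "real \<times> ((real \<times> real) ^ 'n)"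

definition heisenberg :: "'n::finite heis monoid"
  where "heisenberg =
    \<lparr>carrier = UNIV,
     monoid.mult = (\<lambda>(z, v) (z', v').
       (z + z' + 1/2 * (\<Sum>j\<in>UNIV. fst (v $ j) * snd (v' $ j) - fst (v' $ j) * snd (v $ j)),
        v + v')),
     one = (0, 0)\<rparr>"

definition heis_rotation :: "('n::finite \<Rightarrow> real) \<Rightarrow> real \<Rightarrow> 'n heis \<Rightarrow> 'n heis"
  where "heis_rotation a t = (\<lambda>(z, v).
    (z, \<chi> j. (cos (a j * t) * fst (v $ j) - sin (a j * t) * snd (v $ j),
              sin (a j * t) * fst (v $ j) + cos (a j * t) * snd (v $ j))))"

text \<open>The Lie group carries the Euclidean topology of \<open>\<real> \<times> \<real>\<^bsup>2n+1\<^esup>\<close>.\<close>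

definition G_group :: "('n::finite \<Rightarrow> real) \<Rightarrow> (real \<times> 'n heis) monoid"
  where "G_group a = semidirect_product real_group heisenberg (heis_rotation a)"

lemma group_heisenberg: "group (heisenberg :: 'n::finite heis monoid)"
proof (rule groupI)
  fix x y w :: "'n heis"
  obtain z v where x: "x = (z, v)" by (cases x)
  obtain z' v' where y: "y = (z', v')" by (cases y)
  obtain z'' v'' where w: "w = (z'', v'')" by (cases w)
  show "x \<otimes>\<^bsub>heisenberg\<^esub> y \<otimes>\<^bsub>heisenberg\<^esub> w = x \<otimes>\<^bsub>heisenberg\<^esub> (y \<otimes>\<^bsub>heisenberg\<^esub> w)"
    by (simp add: heisenberg_def x y w sum.distrib sum_subtractf add_divide_distrib
        diff_divide_distrib algebra_simps)
  show "\<exists>y\<in>carrier heisenberg. y \<otimes>\<^bsub>heisenberg\<^esub> x = \<one>\<^bsub>heisenberg\<^esub>"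
    by (rule bexI[of _ "(- z, - v)"]) (auto simp: heisenberg_def x algebra_simps)
qed (auto simp: heisenberg_def)

lemma heis_rotation_mult:
  "heis_rotation a t (x \<otimes>\<^bsub>heisenberg\<^esub> y) =
   heis_rotation a t x \<otimes>\<^bsub>heisenberg\<^esub> heis_rotation a t y"
proof -
  have *: "(c * p - s * q) * (s * p' + c * q') - (c * p' - s * q') * (s * p + c * q)
      = p * q' - p' * q"
    if "s\<^sup>2 + c\<^sup>2 = 1" for s c p q p' q' :: real
  proof -
    have "(c * p - s * q) * (s * p' + c * q') - (c * p' - s * q') * (s * p + c * q)
      = (s\<^sup>2 + c\<^sup>2) * (p * q' - p' * q)" by algebra
    then show ?thesis using that by simp
  qed
  obtain z v where x: "x = (z, v)" by (cases x)
  obtain z' v' where y: "y = (z', v')" by (cases y)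
  have "fst (heis_rotation a t (x \<otimes>\<^bsub>heisenberg\<^esub> y)) =
    fst (heis_rotation a t x \<otimes>\<^bsub>heisenberg\<^esub> heis_rotation a t y)"
    by (simp add: x y heisenberg_def heis_rotation_def *)
  moreover have "snd (heis_rotation a t (x \<otimes>\<^bsub>heisenberg\<^esub> y)) =
    snd (heis_rotation a t x \<otimes>\<^bsub>heisenberg\<^esub> heis_rotation a t y)"
    by (simp add: x y heisenberg_def heis_rotation_def vec_eq_iff algebra_simps)
  ultimately show ?thesis by (rule prod_eqI)
qed

lemma heis_rotation_add: "heis_rotation a (s + t) x = heis_rotation a s (heis_rotation a t x)"
  by (cases x)
    (simp add: heis_rotation_def vec_eq_iff cos_add sin_add algebra_simps)

lemma heis_rotation_zero: "heis_rotation a 0 x = x"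
  by (cases x) (simp add: heis_rotation_def vec_eq_iff)

lemma bij_heis_rotation: "bij (heis_rotation a t)"
  by (rule bij_betw_byWitness[where f' = "heis_rotation a (- t)"])
    (auto simp: heis_rotation_add[symmetric] heis_rotation_zero)

lemma heis_rotation_auto: "heis_rotation a t \<in> auto heisenberg"
  using bij_heis_rotation[of a t]
  by (simp add: auto_def hom_def Bij_def heis_rotation_mult) (simp add: heisenberg_def)

lemma heis_rotation_hom: "heis_rotation a \<in> hom real_group (AutoGroup heisenberg)"
proof (rule homI)
  fix s t :: real
  show "heis_rotation a (s \<otimes>\<^bsub>real_group\<^esub> t) =
    heis_rotation a s \<otimes>\<^bsub>AutoGroup heisenberg\<^esub> heis_rotation a t"
    using heis_rotation_auto[of a s] heis_rotation_auto[of a t]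
    by (auto simp: AutoGroup_def BijGroup_def auto_def real_group_def compose_def
        heis_rotation_add heisenberg_def fun_eq_iff)
qed (simp add: AutoGroup_def heis_rotation_auto)

lemma carrier_G_group: "carrier (G_group a) = UNIV"
  by (simp add: G_group_def semidirect_product_def real_group_def heisenberg_def)

lemma one_G_group: "\<one>\<^bsub>G_group a\<^esub> = (0, 0)"
  by (simp add: G_group_def semidirect_product_def real_group_def heisenberg_def zero_prod_def)

lemma mult_G_group:
  "(t, h) \<otimes>\<^bsub>G_group a\<^esub> (t', h') = (t + t', h \<otimes>\<^bsub>heisenberg\<^esub> heis_rotation a t h')"
  by (simp add: G_group_def semidirect_product_def real_group_def)

lemma uminus_heisenberg: "- h \<otimes>\<^bsub>heisenberg\<^esub> h = 0" for h :: "'n::finite heis"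
  by (cases h) (simp add: heisenberg_def zero_prod_def algebra_simps)

lemma heis_rotation_uminus: "heis_rotation a t (- h) = - heis_rotation a t h"
  by (cases h) (simp add: heis_rotation_def vec_eq_iff)

lemma group_G_group: "group (G_group a)"
proof (rule groupI)
  interpret H: group "heisenberg :: 'a heis monoid" by (rule group_heisenberg)
  have UH: "carrier (heisenberg :: 'a heis monoid) = UNIV"
    by (simp add: heisenberg_def)
  fix x y w :: "real \<times> 'a heis"
  show "x \<otimes>\<^bsub>G_group a\<^esub> y \<otimes>\<^bsub>G_group a\<^esub> w = x \<otimes>\<^bsub>G_group a\<^esub> (y \<otimes>\<^bsub>G_group a\<^esub> w)"
    by (cases x; cases y; cases w)
      (simp add: mult_G_group heis_rotation_add heis_rotation_mult H.m_assoc UH)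
  obtain t h where x: "x = (t, h)" by (cases x)
  show "\<one>\<^bsub>G_group a\<^esub> \<otimes>\<^bsub>G_group a\<^esub> x = x"
    using H.l_one[of h]
    by (simp add: x one_G_group mult_G_group heis_rotation_zero UH)
       (simp add: heisenberg_def zero_prod_def)
  show "\<exists>y\<in>carrier (G_group a). y \<otimes>\<^bsub>G_group a\<^esub> x = \<one>\<^bsub>G_group a\<^esub>"
    by (rule bexI[of _ "(- t, - heis_rotation a (- t) h)"])
      (simp_all add: x carrier_G_group mult_G_group one_G_group uminus_heisenberg)
qed (simp_all add: carrier_G_group)

lemma inv_G_group: "inv\<^bsub>G_group a\<^esub> (t, h) = (- t, - heis_rotation a (- t) h)"
  by (rule group.inv_equality[OF group_G_group])
    (simp_all add: carrier_G_group mult_G_group one_G_group uminus_heisenberg)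

lemma continuous_on_heis_rotation:
  fixes S :: "'b::t2_space set"
  assumes "continuous_on S f" "continuous_on S g"
  shows "continuous_on S (\<lambda>x. heis_rotation a (f x) (g x))"
  unfolding heis_rotation_def case_prod_beta
  by (intro continuous_intros assms)

lemma continuous_on_heisenberg_mult:
  assumes "continuous_on S f" "continuous_on S g"
  shows "continuous_on S (\<lambda>x. f x \<otimes>\<^bsub>heisenberg\<^esub> g x)"
  unfolding heisenberg_def case_prod_beta monoid.simps
  by (intro continuous_intros assms)

lemma topological_group_G_group: "topological_group (G_group a) euclidean"
  unfolding topological_group_def
proof (intro conjI)
  have "(\<lambda>(x, y). x \<otimes>\<^bsub>G_group a\<^esub> y) = (\<lambda>p. (fst (fst p) + fst (snd p),
      snd (fst p) \<otimes>\<^bsub>heisenberg\<^esub> heis_rotation a (fst (fst p)) (snd (snd p))))"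
    by (auto simp: fun_eq_iff mult_G_group)
  moreover have "continuous_on UNIV \<dots>"
    by (intro continuous_intros continuous_on_heisenberg_mult continuous_on_heis_rotation)
  ultimately show "continuous_map (prod_topology euclidean euclidean) euclidean
      (\<lambda>(x, y). x \<otimes>\<^bsub>G_group a\<^esub> y)"
    by (simp only: prod_topology_euclidean continuous_map_iff_continuous2)
  have "(\<lambda>x. inv\<^bsub>G_group a\<^esub> x) = (\<lambda>x. (- fst x, - heis_rotation a (- fst x) (snd x)))"
    by (auto simp: fun_eq_iff inv_G_group)
  moreover have "continuous_on UNIV \<dots>"
    by (intro continuous_intros continuous_on_heis_rotation)
  ultimately show "continuous_map euclidean euclidean (\<lambda>x. inv\<^bsub>G_group a\<^esub> x)"
    by (simp only: continuous_map_iff_continuous2)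
qed (simp_all add: group_G_group carrier_G_group)

end

theory Submission
  imports Defs
begin

text \<open>
  A common denominator \<open>d\<close> of the \<open>a\<^sub>j\<close> gives a time \<open>T = 2\<pi>d\<close> at which the rotation
  action is trivial. Hence \<open>T\<int>\<close> acts trivially on \<open>H\<^bsub>2n+1\<^esub>\<close>, and
  \<open>T\<int> \<times> \<frac12>\<int> \<times> \<int>\<^bsup>2n\<^esup>\<close> is a discrete subgroup. Rounding coordinates down shows that its
  translates of the compact box \<open>[0, T] \<times> [0, \<frac12>] \<times> [0, 1]\<^bsup>2n\<^esup>\<close> cover the group.
\<close>

text \<open>The central coordinate ranges over half-integers because the factor 1/2 in the
  Heisenberg product turns integer \<open>x\<close> and \<open>y\<close> coordinates into
  half-integer contributions to \<open>z\<close>.\<close>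

definition standard_lattice :: "real \<Rightarrow> (real \<times> 'n::finite heis) set"
  where "standard_lattice T =
    {(t, z, v). t / T \<in> \<int> \<and> 2 * z \<in> \<int> \<and> (\<forall>j. fst (v $ j) \<in> \<int> \<and> snd (v $ j) \<in> \<int>)}"

text \<open>The product of the individual denominators is a multiple of each of them, so no least
  common multiple is needed.\<close>

lemma common_denominator:
  fixes a :: "'n::finite \<Rightarrow> real"
  assumes "\<forall>i. a i \<in> \<rat>"
  obtains d :: nat where "d > 0" "\<And>i. a i * real d \<in> \<int>"
proof -
  have "\<exists>q::nat. q > 0 \<and> a i * real q \<in> \<int>" for i
  proof -
    from assms obtain m n :: int where "n > 0" "a i = of_int m / of_int n"
      by (meson Rats_cases')
    then show ?thesis
      by (intro exI[of _ "nat n"]) auto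
  qed
  then obtain q :: "'n \<Rightarrow> nat" where q: "\<And>i. q i > 0" "\<And>i. a i * real (q i) \<in> \<int>"
    by metis
  show thesis
  proof (rule that[of "prod q UNIV"])
    show "prod q UNIV > 0" using q by (simp add: prod_pos)
    fix i
    have "a i * real (prod q UNIV) = (a i * real (q i)) * real (prod q (UNIV - {i}))"
      by (subst prod.remove[of UNIV i]) auto
    also have "\<dots> \<in> \<int>" by (intro Ints_mult q Ints_of_nat)
    finally show "a i * real (prod q UNIV) \<in> \<int>" .
  qed
qed

text \<open>Here \<open>a j * T\<close> is an integer multiple of 2 pi and \<open>t\<close> an
  integer multiple of \<open>T\<close>, so every rotation angle \<open>a j * t\<close> is a multiple
  of 2 pi.\<close>

lemma heis_rotation_period:
  assumes "\<forall>j. a j * T / (2 * pi) \<in> \<int>" and "t / T \<in> \<int>" and "T > 0"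
  shows "heis_rotation a t h = h"
proof -
  have "cos (a j * t) = 1 \<and> sin (a j * t) = 0" for j
  proof -
    have "(a j * T / (2 * pi)) * (t / T) \<in> \<int>" using assms by (intro Ints_mult) auto
    then obtain k :: int where "(a j * T / (2 * pi)) * (t / T) = of_int k" by (auto elim: Ints_cases)
    then have "a j * t = 2 * pi * of_int k" using \<open>T > 0\<close> by (simp add: field_simps)
    then show ?thesis using cos_int_2pin sin_int_2pin by metis
  qed
  then show ?thesis by (cases h) (simp add: heis_rotation_def vec_eq_iff)
qed

text \<open>All rotations at times occurring in the set are trivial, so products and inverses are
  those of the direct product of the real line with the Heisenberg group.\<close>

lemma subgroup_standard_lattice:
  fixes a :: "'n::finite \<Rightarrow> real"
  assumes T: "T > 0" and per: "\<forall>j. a j * T / (2 * pi) \<in> \<int>"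
  shows "subgroup (standard_lattice T) (G_group a)"
proof (rule group.subgroupI[OF group_G_group])
  show "standard_lattice T \<subseteq> carrier (G_group a)" by (simp add: carrier_G_group)
  have "(0, 0, 0) \<in> standard_lattice T" by (simp add: standard_lattice_def)
  then show "standard_lattice T \<noteq> {}" by blast
next
  fix g :: "real \<times> 'n heis" assume g: "g \<in> standard_lattice T"
  obtain t z v where eq: "g = (t, z, v)" by (cases g)
  have "(- t) / T \<in> \<int>" using g by (simp add: eq standard_lattice_def)
  then have "inv\<^bsub>G_group a\<^esub> g = (- t, - z, - v)"
    using heis_rotation_period[OF per _ T] by (simp add: eq inv_G_group)
  then show "inv\<^bsub>G_group a\<^esub> g \<in> standard_lattice T"
    using g by (simp add: eq standard_lattice_def)
next
  fix g h :: "real \<times> 'n heis" assume g: "g \<in> standard_lattice T" and h: "h \<in> standard_lattice T"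
  obtain t z v where eq: "g = (t, z, v)" by (cases g)
  obtain t' z' v' where eq': "h = (t', z', v')" by (cases h)
  have "t / T \<in> \<int>" using g by (simp add: eq standard_lattice_def)
  then have prod: "g \<otimes>\<^bsub>G_group a\<^esub> h = (t + t', z + z' +
      1/2 * (\<Sum>j\<in>UNIV. fst (v $ j) * snd (v' $ j) - fst (v' $ j) * snd (v $ j)), v + v')"
    using heis_rotation_period[OF per _ T] by (simp add: eq eq' mult_G_group heisenberg_def)
  \<comment> \<open>The twist is half of this integer, so the new \<open>z\<close> coordinate is
    again a half-integer.\<close>
  have "(\<Sum>j\<in>UNIV. fst (v $ j) * snd (v' $ j) - fst (v' $ j) * snd (v $ j)) \<in> \<int>"
    using g h by (intro Ints_sum Ints_diff Ints_mult) (auto simp: eq eq' standard_lattice_def)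
  then show "g \<otimes>\<^bsub>G_group a\<^esub> h \<in> standard_lattice T"
    using g h unfolding prod
    by (simp add: eq eq' standard_lattice_def distrib_left add_divide_distrib)
qed

lemma Ints_eqI:
  fixes x y :: real
  assumes "x \<in> \<int>" "y \<in> \<int>" "\<bar>x - y\<bar> < 1"
  shows "x = y"
  using assms by (metis Ints_diff Ints_nonzero_abs_less1 eq_iff_diff_eq_0)

lemma discrete_standard_lattice:
  assumes T: "T > 0"
  shows "subtopology euclidean (standard_lattice T :: (real \<times> 'n::finite heis) set) =
    discrete_topology (standard_lattice T)"
proof -
  \<comment> \<open>Within the set, distinct values of \<open>t\<close> differ by at least
    \<open>T\<close>, of \<open>z\<close> by at least 1/2, and of the other coordinates by at least
    1; \<open>r\<close> is the smallest of these gaps.\<close>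
  define r where "r = min T (1/2)"
  have r: "r > 0" "r \<le> T" "r \<le> 1/2" using T by (auto simp: r_def)
  have eqI: "g = h" if g: "g \<in> standard_lattice T" and h: "h \<in> standard_lattice T"
    and d: "dist g h < r" for g h :: "real \<times> 'n heis"
  proof -
    obtain t z v where eq: "g = (t, z, v)" by (cases g)
    obtain t' z' v' where eq': "h = (t', z', v')" by (cases h)
    have dt: "\<bar>t - t'\<bar> < r" and dzv: "dist (z, v) (z', v') < r"
      using d dist_fst_le[of g h] dist_snd_le[of g h] by (auto simp: eq eq' dist_real_def)
    have dz: "\<bar>z - z'\<bar> < r" and dv: "dist v v' < r"
      using dzv dist_fst_le[of "(z, v)" "(z', v')"] dist_snd_le[of "(z, v)" "(z', v')"]
      by (auto simp: dist_real_def)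
    have "\<bar>t / T - t' / T\<bar> = \<bar>t - t'\<bar> / T" using T by (simp flip: diff_divide_distrib)
    also have "\<dots> < 1" using T dt r by simp
    finally have "t / T = t' / T"
      using g h by (intro Ints_eqI) (auto simp: eq eq' standard_lattice_def)
    moreover have "2 * z = 2 * z'"
      using g h dz r by (intro Ints_eqI) (auto simp: eq eq' standard_lattice_def)
    moreover have "v $ j = v' $ j" for j
    proof (rule prod_eqI)
      have dj: "dist (v $ j) (v' $ j) < r" using dist_vec_nth_le[of v j v'] dv by linarith
      have "\<bar>fst (v $ j) - fst (v' $ j)\<bar> < 1"
        using dist_fst_le[of "v $ j" "v' $ j"] dj r by (simp add: dist_real_def)
      then show "fst (v $ j) = fst (v' $ j)"
        using g h by (intro Ints_eqI) (auto simp: eq eq' standard_lattice_def)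
      have "\<bar>snd (v $ j) - snd (v' $ j)\<bar> < 1"
        using dist_snd_le[of "v $ j" "v' $ j"] dj r by (simp add: dist_real_def)
      then show "snd (v $ j) = snd (v' $ j)"
        using g h by (intro Ints_eqI) (auto simp: eq eq' standard_lattice_def)
    qed
    ultimately show ?thesis using T by (simp add: eq eq' vec_eq_iff)
  qed
  have "openin (subtopology euclidean (standard_lattice T)) {g}"
    if "g \<in> standard_lattice T" for g :: "real \<times> 'n heis"
  proof -
    have "{g} = ball g r \<inter> standard_lattice T"
      using eqI[OF that, symmetric] that r(1) by auto
    then show ?thesis by (auto simp: openin_subtopology)
  qed
  then have "discrete_topology (standard_lattice T) =
      subtopology euclidean (standard_lattice T :: (real \<times> 'n heis) set)"
    by (simp add: discrete_topology_unique)
  then show ?thesis by (rule sym)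
qed

text \<open>Heine-Borel: the norm of a vector is at most the sum of the norms of its components, and
  the set is an intersection of closed preimages under the coordinate projections.\<close>

lemma compact_vec_Times:
  fixes A B :: "real set"
  assumes "compact A" "compact B"
  shows "compact {v :: (real \<times> real) ^ 'n::finite. \<forall>j. v $ j \<in> A \<times> B}"
proof -
  have AB: "compact (A \<times> B)" by (intro compact_Times assms)
  then obtain M where M: "\<And>x. x \<in> A \<times> B \<Longrightarrow> norm x \<le> M"
    using compact_imp_bounded bounded_iff by metis
  have "norm v \<le> (\<Sum>j\<in>(UNIV::'n set). M)" if "\<forall>j. v $ j \<in> A \<times> B" for v :: "(real \<times> real) ^ 'n"
    unfolding norm_vec_def using that M by (intro order_trans[OF L2_set_le_sum] sum_mono) auto
  then have "bounded {v :: (real \<times> real) ^ 'n. \<forall>j. v $ j \<in> A \<times> B}"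
    unfolding bounded_iff by blast
  moreover have "closed {v :: (real \<times> real) ^ 'n. \<forall>j. v $ j \<in> A \<times> B}"
    using compact_imp_closed[OF AB]
    by (intro closed_Collect_all closed_vimage_vec_nth[unfolded vimage_def])
  ultimately show ?thesis by (simp add: compact_eq_bounded_closed)
qed

text \<open>For compactness, the quotient is the image of the compact box \<open>K\<close> under the
  continuous projection \<open>?p\<close>; it remains to move each \<open>g\<close> into
  \<open>K\<close> by a lattice element.\<close>

lemma lattice_in_standard_lattice:
  fixes a :: "'n::finite \<Rightarrow> real"
  assumes T: "T > 0" and per: "\<forall>j. a j * T / (2 * pi) \<in> \<int>"
  shows "lattice_in (G_group a) euclidean (standard_lattice T)"
  unfolding lattice_in_def
proof (intro conjI subgroup_standard_lattice discrete_standard_lattice assms)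
  let ?\<Gamma> = "standard_lattice T :: (real \<times> 'n heis) set"
  let ?p = "\<lambda>g. ?\<Gamma> #>\<^bsub>G_group a\<^esub> g"
  let ?Q = "quotient_topology euclidean ?p"
  interpret G: group "G_group a" by (rule group_G_group)
  have sub: "subgroup ?\<Gamma> (G_group a)" by (rule subgroup_standard_lattice[OF assms])
  define K :: "(real \<times> 'n heis) set"
    where "K = {0..T} \<times> {0..1/2} \<times> {v. \<forall>j. v $ j \<in> {0..1} \<times> {0..1}}"
  have "compact K"
    unfolding K_def by (intro compact_Times compact_vec_Times compact_Icc)
  have "range ?p \<subseteq> ?p ` K"
  proof (rule image_subsetI)
    fix g :: "real \<times> 'n heis"
    obtain t z v where eq: "g = (t, z, v)" by (cases g)
    define k where "k = of_int \<lfloor>t / T\<rfloor> * T"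
    define w :: "(real \<times> real) ^ 'n"
      where "w = (\<chi> j. (of_int \<lfloor>fst (v $ j)\<rfloor>, of_int \<lfloor>snd (v $ j)\<rfloor>))"
    define u where "u = v - w"
    \<comment> \<open>Multiplying by \<open>w\<close> on the left adds a twist to the central
      coordinate. It depends on \<open>w\<close> and \<open>u\<close> only, so it is subtracted from
      \<open>z\<close> before rounding down to the half-integer \<open>m\<close>.\<close>
    define c where
      "c = z - 1/2 * (\<Sum>j\<in>UNIV. fst (w $ j) * snd (u $ j) - fst (u $ j) * snd (w $ j))"
    define m :: real where "m = of_int \<lfloor>2 * c\<rfloor> / 2"
    have mem: "(k, m, w) \<in> ?\<Gamma>" using T by (simp add: standard_lattice_def k_def m_def w_def)
    have "k / T \<in> \<int>" using T by (simp add: k_def)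
    \<comment> \<open>Time \<open>k\<close> acts trivially, so the Heisenberg parts multiply without
      rotation and the twist built into \<open>c\<close> cancels.\<close>
    then have prod: "(k, m, w) \<otimes>\<^bsub>G_group a\<^esub> (t - k, c - m, u) = g"
      using heis_rotation_period[OF per _ T]
      by (simp add: eq mult_G_group heisenberg_def c_def) (simp add: u_def)
    have "k \<le> t" "t \<le> k + T"
      using floor_divide_lower[OF T, of t] floor_divide_upper[OF T, of t]
      by (simp_all add: k_def distrib_right)
    moreover have "m \<le> c" "c \<le> m + 1/2" unfolding m_def by linarith+
    moreover have "u $ j \<in> {0..1} \<times> {0..1}" for j
      by (cases "v $ j") (simp add: u_def w_def, linarith)
    ultimately have "(t - k, c - m, u) \<in> K" by (simp add: K_def)
    moreover have "?p g = ?p (t - k, c - m, u)"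
    proof -
      have "g \<in> ?p (t - k, c - m, u)" using mem prod by (auto simp: r_coset_def)
      then show ?thesis
        using G.repr_independence[OF _ _ sub] by (simp add: carrier_G_group)
    qed
    ultimately show "?p g \<in> ?p ` K" by blast
  qed
  then have "?p ` K = topspace ?Q" by (auto simp: topspace_quotient_topology)
  moreover have "compactin ?Q (?p ` K)"
    using \<open>compact K\<close>
    by (intro image_compactin[of euclidean] quotient_imp_continuous_map
        quotient_map_quotient_topology) simp
  ultimately show "compact_space ?Q" by (simp add: compact_space_def)
qed

theorem proposition6p4:
  fixes a :: "'n::{finite, linorder} \<Rightarrow> real"
  assumes "mono a"
    and "\<not> (\<forall>i. a i = 0)"
    and "\<forall>i. a i \<in> \<rat>"
  shows "\<exists>\<Gamma>. lattice_in (G_group a) euclidean \<Gamma>"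
proof -
  obtain d :: nat where d: "d > 0" "\<And>i. a i * real d \<in> \<int>"
    using common_denominator[OF assms(3)] by blast
  \<comment> \<open>With this period, \<open>a j * T / (2 * pi)\<close> reduces to the integer
    \<open>a j * real d\<close>.\<close>
  have "lattice_in (G_group a) euclidean (standard_lattice (2 * pi * real d))"
  proof (rule lattice_in_standard_lattice)
    have "a j * (2 * pi * real d) / (2 * pi) = a j * real d" for j by simp
    then show "\<forall>j. a j * (2 * pi * real d) / (2 * pi) \<in> \<int>" using d(2) by simp
  qed (simp add: d(1))
  then show ?thesis by blast
qed

end
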